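(* Let $1\le p<q\le\infty$ (with $\frac1q=\frac pq=0$ if $q=\infty$). There is a constant $C>0$ depending only on $p$ and $q$ such that for all $m,n\in\mathbb{N}$ with $m\ge2$, $$e^{\mathrm{ran,nonada}}(n,\ell_p^m\hookrightarrow\ell_q^m)\le C\cdot\begin{cases}\min\left\{1,\left(\frac{\log m}{n}\right)^{\frac1p-\frac1q}\right\}&\text{for }1\le p\le2,\\ \min\left\{1,\left(\frac{m^{1-2/p}\cdot\log m}{n}\right)^{\frac12\left(1-\frac pq\right)}\right\}&\text{for }p>2,\end{cases}$$ and for all $m\in\mathbb{N}$ with $m\ge2$ and all $\varepsilon\in(0,1)$, $$n^{\mathrm{ran,nonada}}(\varepsilon,\ell_p^m\hookrightarrow\ell_q^m)\le C\cdot\begin{cases}\varepsilon^{-1/\left(\frac1p-\frac1q\right)}\cdot\log m&\text{for }1\le p\le2,\\ \varepsilon^{-\frac2p/\left(\frac1p-\frac1q\right)}\cdot m^{1-\frac2p}\cdot\log m&\text{for }p>2.\end{cases}$$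
   Context: $\log$ is the natural logarithm. A non-adaptive randomized algorithm of cardinality $n$ for the problem $\ell_p^m\hookrightarrow\ell_q^m$ is a family $A=(A^\omega)_{\omega\in\Omega}$ of maps $A^\omega:\mathbb{R}^m\to\mathbb{R}^m$, indexed by a probability space $(\Omega,\Sigma,\mathbb{P})$, of the form $A^\omega(\mathbf{x})=\phi^\omega(N^\omega\mathbf{x})$ with a random matrix $N^\omega\in\mathbb{R}^{n\times m}$ (not depending on $\mathbf{x}$) and an arbitrary, possibly random and non-linear, map $\phi^\omega:\mathbb{R}^n\to\mathbb{R}^m$ (such that $A(\mathbf{x}):\omega\mapsto A^\omega(\mathbf{x})$ is a random variable for each $\mathbf{x}$). Its error is $e(A,\ell_p^m\hookrightarrow\ell_q^m)=\sup_{\|\mathbf{x}\|_p\le1}\mathbb{E}\,\|\mathbf{x}-A(\mathbf{x})\|_q$. Then $e^{\mathrm{ran,nonada}}(n,\ell_p^m\hookrightarrow\ell_q^m)$ is the infimum of the errors over non-adaptive randomized algorithms of cardinality at most $n$, and $n^{\mathrm{ran,nonada}}(\varepsilon,\ell_p^m\hookrightarrow\ell_q^m)$ is the infimum of the cardinalities of non-adaptive randomized algorithms with error at most $\varepsilon$. *)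

theory Defs
  imports "HOL-Probability.Probability"
begin

text \<open>
  The dimension varies inside the statements, so a vector in \<open>\<real>\<^sup>m\<close> is a function
  \<open>x \<in> {..<m} \<rightarrow>\<^sub>E UNIV\<close>, and an \<open>n \<times> m\<close> matrix is an extensional function
  on \<open>{..<n} \<times> {..<m}\<close>.  Both sets carry their Borel \<open>\<sigma>\<close>-algebra, as
  finite products of \<open>borel\<close>.
\<close>

definition vec_space :: "nat \<Rightarrow> (nat \<Rightarrow> real) measure" where
  "vec_space m = PiM {..<m} (\<lambda>_. borel)"

definition mat_space :: "nat \<Rightarrow> nat \<Rightarrow> (nat \<times> nat \<Rightarrow> real) measure" where
  "mat_space n m = PiM ({..<n} \<times> {..<m}) (\<lambda>_. borel)"

abbreviation Rvec :: "nat \<Rightarrow> (nat \<Rightarrow> real) set" where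
  "Rvec m \<equiv> {..<m} \<rightarrow>\<^sub>E UNIV"

definition mat_vec :: "nat \<Rightarrow> nat \<Rightarrow> (nat \<times> nat \<Rightarrow> real) \<Rightarrow> (nat \<Rightarrow> real) \<Rightarrow> nat \<Rightarrow> real" where
  "mat_vec n m N x = (\<lambda>i\<in>{..<n}. \<Sum>j<m. N (i, j) * x j)"

text \<open>
  The \<open>\<ell>\<^sub>p\<close>-norm of the first \<open>m\<close> coordinates, for \<open>1 \<le> p \<le> \<infinity>\<close>
  and \<open>m \<ge> 1\<close>.
\<close>

definition lp_norm :: "ereal \<Rightarrow> nat \<Rightarrow> (nat \<Rightarrow> real) \<Rightarrow> real" where
  "lp_norm p m x =
     (if p = \<infinity> then Max ((\<lambda>i. \<bar>x i\<bar>) ` {..<m})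
      else (\<Sum>i<m. \<bar>x i\<bar> powr real_of_ereal p) powr (1 / real_of_ereal p))"

text \<open>
  Only the information \<open>N \<omega>\<close> and the outputs \<open>\<lambda>\<omega>. A \<omega> x\<close> are required to be
  measurable; the reconstruction \<open>\<phi> \<omega>\<close> is arbitrary.
\<close>

definition nonada_alg ::
  "nat \<Rightarrow> nat \<Rightarrow> 'w measure \<Rightarrow> ('w \<Rightarrow> (nat \<Rightarrow> real) \<Rightarrow> (nat \<Rightarrow> real)) \<Rightarrow> bool" where
  "nonada_alg n m M A \<longleftrightarrow>
     prob_space M \<and>
     (\<exists>N \<phi>. N \<in> M \<rightarrow>\<^sub>M mat_space n m \<and>
            (\<forall>\<omega>\<in>space M. \<phi> \<omega> \<in> Rvec n \<rightarrow> Rvec m) \<and>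
            (\<forall>\<omega>\<in>space M. \<forall>x\<in>Rvec m. A \<omega> x = \<phi> \<omega> (mat_vec n m (N \<omega>) x))) \<and>
     (\<forall>x\<in>Rvec m. (\<lambda>\<omega>. A \<omega> x) \<in> M \<rightarrow>\<^sub>M vec_space m)"

definition alg_error ::
  "ereal \<Rightarrow> ereal \<Rightarrow> nat \<Rightarrow> 'w measure \<Rightarrow> ('w \<Rightarrow> (nat \<Rightarrow> real) \<Rightarrow> (nat \<Rightarrow> real)) \<Rightarrow> ennreal" where
  "alg_error p q m M A =
     (SUP x\<in>{x \<in> Rvec m. lp_norm p m x \<le> 1}.
        \<integral>\<^sup>+ \<omega>. ennreal (lp_norm q m (\<lambda>i. x i - A \<omega> x i)) \<partial>M)"

text \<open>
  HOL cannot range over probability spaces of all types at once, so the type \<open>'w\<close> of the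
  sample points is a parameter; \<open>M\<close> ranges over all probability spaces on subsets of
  \<open>'w\<close>.  Both infima live in \<^typ>\<open>ennreal\<close>, so that an empty infimum is \<open>\<infinity>\<close>.
\<close>

definition e_ran_nonada :: "'w itself \<Rightarrow> nat \<Rightarrow> ereal \<Rightarrow> ereal \<Rightarrow> nat \<Rightarrow> ennreal" where
  "e_ran_nonada T n p q m =
     Inf {alg_error p q m M A | k (M :: 'w measure) A. k \<le> n \<and> nonada_alg k m M A}"

definition n_ran_nonada :: "'w itself \<Rightarrow> real \<Rightarrow> ereal \<Rightarrow> ereal \<Rightarrow> nat \<Rightarrow> ennreal" where
  "n_ran_nonada T \<epsilon> p q m =
     Inf {of_nat k | k (M :: 'w measure) A.
            nonada_alg k m M A \<and> alg_error p q m M A \<le> ennreal \<epsilon>}"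

text \<open>
  Enlarging the sample type can only decrease both quantities.  Hence upper bounds for one type
  hold, with the same constant, for every type into which it embeds.
\<close>

lemma nonada_alg_transfer:
  fixes f :: "'a \<Rightarrow> 'b" and M :: "'a measure"
  assumes f: "inj f" and A: "nonada_alg n m M A"
  shows "nonada_alg n m (embed_measure M f) (\<lambda>\<omega>. A (inv f \<omega>))"
    and "alg_error p q m (embed_measure M f) (\<lambda>\<omega>. A (inv f \<omega>)) = alg_error p q m M A"
proof -
  interpret prob_space M using A by (simp add: nonada_alg_def)
  have inv: "inv f \<in> embed_measure M f \<rightarrow>\<^sub>M M"
    using f by (intro measurable_embed_measure1) (simp add: inv_f_f)
  have f_meas: "f \<in> M \<rightarrow>\<^sub>M embed_measure M f"
    using f by (rule measurable_embed_measure2)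
  have distr: "embed_measure M f = distr M (embed_measure M f) f"
    using f by (rule embed_measure_eq_distr)
  have prob: "prob_space (embed_measure M f)"
    by (subst distr) (rule prob_space_distr[OF f_meas])
  obtain N \<phi> where N: "N \<in> M \<rightarrow>\<^sub>M mat_space n m"
    and \<phi>: "\<forall>\<omega>\<in>space M. \<phi> \<omega> \<in> Rvec n \<rightarrow> Rvec m"
    and eq: "\<forall>\<omega>\<in>space M. \<forall>x\<in>Rvec m. A \<omega> x = \<phi> \<omega> (mat_vec n m (N \<omega>) x)"
    using A unfolding nonada_alg_def by blast
  have N': "(\<lambda>\<omega>. N (inv f \<omega>)) \<in> embed_measure M f \<rightarrow>\<^sub>M mat_space n m"
    using inv N by (rule measurable_compose)
  have \<phi>': "\<forall>\<omega>\<in>space (embed_measure M f). \<phi> (inv f \<omega>) \<in> Rvec n \<rightarrow> Rvec m"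
    using \<phi> measurable_space[OF inv] by blast
  have eq': "\<forall>\<omega>\<in>space (embed_measure M f). \<forall>x\<in>Rvec m.
      A (inv f \<omega>) x = \<phi> (inv f \<omega>) (mat_vec n m (N (inv f \<omega>)) x)"
    using eq measurable_space[OF inv] by blast
  have meas: "(\<lambda>\<omega>. A \<omega> x) \<in> M \<rightarrow>\<^sub>M vec_space m" if "x \<in> Rvec m" for x
    using A that unfolding nonada_alg_def by blast
  have meas': "\<forall>x\<in>Rvec m. (\<lambda>\<omega>. A (inv f \<omega>) x) \<in> embed_measure M f \<rightarrow>\<^sub>M vec_space m"
    using measurable_compose[OF inv meas] by blast
  show "nonada_alg n m (embed_measure M f) (\<lambda>\<omega>. A (inv f \<omega>))"
    unfolding nonada_alg_def
    by (intro conjI exI[of _ "\<lambda>\<omega>. N (inv f \<omega>)"] exI[of _ "\<lambda>\<omega>. \<phi> (inv f \<omega>)"])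
      (rule prob N' \<phi>' eq' meas')+
  show "alg_error p q m (embed_measure M f) (\<lambda>\<omega>. A (inv f \<omega>)) = alg_error p q m M A"
    unfolding alg_error_def
  proof (rule SUP_cong[OF refl])
    fix x assume "x \<in> {x \<in> Rvec m. lp_norm p m x \<le> 1}"
    then have x: "x \<in> Rvec m" by simp
    have comp: "(\<lambda>\<omega>. A \<omega> x i) \<in> borel_measurable M" if "i < m" for i
      using measurable_compose[OF meas[OF x, unfolded vec_space_def]
          measurable_component_singleton[of i "{..<m}"]] that by simp
    have nrm: "(\<lambda>\<omega>. lp_norm q m (\<lambda>i. x i - A \<omega> x i)) \<in> borel_measurable M"
    proof (cases "q = \<infinity>")
      case True
      show ?thesis unfolding lp_norm_def if_P[OF True]
        using comp by (intro borel_measurable_Max) auto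
    next
      case False
      show ?thesis unfolding lp_norm_def if_not_P[OF False]
        using comp by (intro powr_real_measurable borel_measurable_sum) auto
    qed
    have inv_nrm: "(\<lambda>\<omega>. ennreal (lp_norm q m (\<lambda>i. x i - A (inv f \<omega>) x i)))
        \<in> borel_measurable (embed_measure M f)"
      using measurable_compose[OF inv nrm] by simp
    show "(\<integral>\<^sup>+ \<omega>. ennreal (lp_norm q m (\<lambda>i. x i - A (inv f \<omega>) x i)) \<partial>embed_measure M f) =
        (\<integral>\<^sup>+ \<omega>. ennreal (lp_norm q m (\<lambda>i. x i - A \<omega> x i)) \<partial>M)"
      using f by (subst nn_integral_embed_measure[OF f inv_nrm]) (simp add: inv_f_f)
  qed
qed

lemma ran_nonada_antimono_sample_type:
  fixes f :: "'a \<Rightarrow> 'b"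
  assumes f: "inj f"
  shows "e_ran_nonada TYPE('b) n p q m \<le> e_ran_nonada TYPE('a) n p q m"
    and "n_ran_nonada TYPE('b) \<epsilon> p q m \<le> n_ran_nonada TYPE('a) \<epsilon> p q m"
proof -
  show "e_ran_nonada TYPE('b) n p q m \<le> e_ran_nonada TYPE('a) n p q m"
    unfolding e_ran_nonada_def
  proof (rule Inf_superset_mono, safe)
    fix k :: nat and M :: "'a measure" and A
    assume "k \<le> n" "nonada_alg k m M A"
    then show "\<exists>k' (M' :: 'b measure) A'. alg_error p q m M A = alg_error p q m M' A' \<and>
        k' \<le> n \<and> nonada_alg k' m M' A'"
      using nonada_alg_transfer[OF f] by (intro exI[of _ k] exI[of _ "embed_measure M f"]
          exI[of _ "\<lambda>\<omega>. A (inv f \<omega>)"]) simp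
  qed
  show "n_ran_nonada TYPE('b) \<epsilon> p q m \<le> n_ran_nonada TYPE('a) \<epsilon> p q m"
    unfolding n_ran_nonada_def
  proof (rule Inf_superset_mono, safe)
    fix k :: nat and M :: "'a measure" and A
    assume "nonada_alg k m M A" "alg_error p q m M A \<le> ennreal \<epsilon>"
    then show "\<exists>k' (M' :: 'b measure) A'. (of_nat k :: ennreal) = of_nat k' \<and>
        nonada_alg k' m M' A' \<and> alg_error p q m M' A' \<le> ennreal \<epsilon>"
      using nonada_alg_transfer[OF f] by (intro exI[of _ k] exI[of _ "embed_measure M f"]
          exI[of _ "\<lambda>\<omega>. A (inv f \<omega>)"]) simp
  qed
qed

end

theory Submission
  imports Defs
begin

text \<open>
  The upper bounds are attained by a count sketch: hash the \<open>m\<close> coordinates into \<open>B\<close> buckets,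
  measure in each bucket the sum of its entries with random signs, and repeat this independently
  \<open>R\<close> times, which costs \<open>R * B\<close> measurements.  In one repetition the bucket of the coordinate
  \<open>j\<close>, multiplied by the sign of \<open>j\<close>, equals \<open>x j\<close> plus noise from the coordinates that collide
  with \<open>j\<close>.

  What controls the noise is the truncated energy
  \<open>S = \<Sum>i<m. (min 1 (\<bar>x i\<bar> / \<tau>))\<^sup>2\<close>.  Each entry larger than \<open>\<tau>\<close> shares the bucket of
  \<open>j\<close> with probability \<open>1 / B\<close>.  The signs make the smaller entries uncorrelated, so Chebyshev's
  inequality bounds the probability that their noise exceeds \<open>\<tau>\<close> by their
  part of \<open>S\<close>, divided by \<open>B\<close>.  Together: the estimate is off by more than \<open>\<tau>\<close> with probability
  at most \<open>S / B\<close> (\<open>card_noisy_rows\<close>).  On the unit ball of \<open>\<ell>\<^sub>p\<close> one has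
  \<open>S \<le> W / \<tau> powr s\<close> with \<open>s = min p 2\<close>, where \<open>W = 1\<close> for \<open>p \<le> 2\<close> and
  \<open>W = m powr (1 - 2 / p)\<close> otherwise (\<open>sum_truncated_squares\<close>), so
  \<open>\<tau> powr s = 16 * W / B\<close> makes this probability at most \<open>1 / 16\<close>.  This is the only place at
  which the two ranges of \<open>p\<close> differ.

  With \<open>R\<close> of order \<open>ln m\<close>, a majority vote over the repetitions (\<open>card_majority_bad\<close>) brings
  the failure probability down to \<open>m powr (-3)\<close> per coordinate, so that all \<open>m\<close> coordinates are
  simultaneously known up to \<open>2 * \<tau>\<close> except with probability \<open>m powr (-2)\<close>.  This gives the bound
  for \<open>q = \<infinity>\<close>.  For smaller \<open>q\<close> the estimates below \<open>4 * \<tau>\<close> are replaced by zero.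
  The error in a coordinate is then at most \<open>3 * min (2 * \<tau>) \<bar>x i\<bar>\<close>, and interpolating between
  \<open>\<ell>\<^sub>p\<close> and \<open>\<ell>\<^sub>\<infinity>\<close> turns this into an \<open>\<ell>\<^sub>q\<close> error of order \<open>\<tau> powr (1 - p / q)\<close>
  (\<open>lp_norm_le_interpolation\<close>).  Outputs are confined to \<open>[-1, 1]\<close>, so the rare failures contribute
  \<open>O(1 / m)\<close> to the expected error; for \<open>n < m\<close> this is of the claimed order.

  The remaining cases are trivial: for \<open>n \<ge> m\<close> the identity matrix recovers \<open>x\<close>, and when \<open>n\<close> is
  too small for the sketch the claimed bound is of constant order and zero is a good enough output.
  The bound for the cardinality results from solving the error bound for \<open>n\<close>.
\<close>

section \<open>Norms\<close>

lemma lp_norm_nonneg: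
  assumes "0 < m"
  shows "0 \<le> lp_norm q m x"
proof (cases "q = \<infinity>")
  case True
  have "\<bar>x 0\<bar> \<le> Max ((\<lambda>i. \<bar>x i\<bar>) ` {..<m})" using assms by (intro Max_ge) auto
  then show ?thesis using True by (simp add: lp_norm_def)
qed (simp add: lp_norm_def)

lemma lp_norm_cong:
  assumes "\<And>i. i < m \<Longrightarrow> x i = y i"
  shows "lp_norm q m x = lp_norm q m y"
proof -
  have "(\<lambda>i. \<bar>x i\<bar>) ` {..<m} = (\<lambda>i. \<bar>y i\<bar>) ` {..<m}"
    using assms by (intro image_cong) auto
  moreover have "(\<Sum>i<m. \<bar>x i\<bar> powr t) = (\<Sum>i<m. \<bar>y i\<bar> powr t)" for t
    using assms by (intro sum.cong) auto
  ultimately show ?thesis by (simp add: lp_norm_def)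
qed

lemma lp_norm_le_one_imp:
  fixes p :: real
  assumes p: "1 \<le> p" and x: "lp_norm (ereal p) m x \<le> 1"
  shows "(\<Sum>i<m. \<bar>x i\<bar> powr p) \<le> 1" and "i < m \<Longrightarrow> \<bar>x i\<bar> \<le> 1"
proof -
  have "(\<Sum>i<m. \<bar>x i\<bar> powr p) powr (1 / p) \<le> 1" using x by (simp add: lp_norm_def)
  then have "((\<Sum>i<m. \<bar>x i\<bar> powr p) powr (1 / p)) powr p \<le> 1 powr p"
    using p by (intro powr_mono2) auto
  then show s: "(\<Sum>i<m. \<bar>x i\<bar> powr p) \<le> 1"
    using p by (simp add: powr_powr sum_nonneg)
  assume i: "i < m"
  have "\<bar>x i\<bar> powr p \<le> (\<Sum>i<m. \<bar>x i\<bar> powr p)"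
    using i by (intro member_le_sum) auto
  then have "\<bar>x i\<bar> powr p \<le> 1" using s by simp
  then show "\<bar>x i\<bar> \<le> 1"
    using p gr_one_powr[of "\<bar>x i\<bar>" p] by (meson less_le_trans not_le zero_less_one)
qed

text \<open>
  The crude bound for those outcomes in which the sketch fails.
\<close>

lemma lp_norm_le_dimension:
  assumes q: "1 \<le> q" and m: "0 < m"
    and e: "\<And>i. i < m \<Longrightarrow> \<bar>e i\<bar> \<le> 2"
  shows "lp_norm q m e \<le> 2 * real m"
proof (cases "q = \<infinity>")
  case True
  have "Max ((\<lambda>i. \<bar>e i\<bar>) ` {..<m}) \<le> 2 * real m"
    using m e by (subst Max_le_iff) force+
  then show ?thesis using True by (simp add: lp_norm_def)
next
  case False
  then obtain r where r: "q = ereal r" using q by (cases q) auto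
  then have r1: "1 \<le> r" using q by (simp add: one_ereal_def)
  have "(\<Sum>i<m. \<bar>e i\<bar> powr r) \<le> (\<Sum>i<m. 2 powr r)"
    using e r1 by (intro sum_mono powr_mono2) auto
  then have "(\<Sum>i<m. \<bar>e i\<bar> powr r) powr (1 / r) \<le> (real m * 2 powr r) powr (1 / r)"
    using r1 by (intro powr_mono2) (auto intro: sum_nonneg)
  also have "\<dots> = 2 * real m powr (1 / r)"
    using r1 by (simp add: powr_mult powr_powr)
  also have "\<dots> \<le> 2 * real m powr 1"
    using r1 m by (intro mult_left_mono powr_mono) auto
  finally show ?thesis using r m by (simp add: lp_norm_def)
qed

text \<open>
  Interpolation between \<open>\<ell>\<^sub>p\<close> and \<open>\<ell>\<^sub>\<infinity>\<close>: for finite \<open>q\<close>, \<open>min \<delta> \<bar>x i\<bar> powr q\<close>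
  is at most \<open>\<delta> powr (q - p) * \<bar>x i\<bar> powr p\<close>, and the second factors sum to at most \<open>1\<close>.
  This is why thresholding at the accuracy level suffices for every \<open>q > p\<close>.
\<close>

lemma lp_norm_le_interpolation:
  fixes p :: real
  assumes p: "1 \<le> p" and pq: "ereal p < q" and m: "0 < m" and \<delta>: "0 < \<delta>"
    and x: "lp_norm (ereal p) m x \<le> 1"
    and e: "\<And>i. i < m \<Longrightarrow> \<bar>e i\<bar> \<le> 3 * min \<delta> \<bar>x i\<bar>"
  shows "lp_norm q m e \<le> 3 * \<delta> powr (1 - real_of_ereal (ereal p / q))"
proof (cases "q = \<infinity>")
  case True
  have "Max ((\<lambda>i. \<bar>e i\<bar>) ` {..<m}) \<le> 3 * \<delta>"
    using m e by (subst Max_le_iff) force+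
  then show ?thesis using True \<delta> by (simp add: lp_norm_def)
next
  case False
  then obtain r where r: "q = ereal r" using pq by (cases q) auto
  then have pr: "p < r" using pq by simp
  have t: "\<bar>e i\<bar> powr r \<le> 3 powr r * \<delta> powr (r - p) * \<bar>x i\<bar> powr p" if "i < m" for i
  proof -
    have "\<bar>e i\<bar> powr r \<le> (3 * min \<delta> \<bar>x i\<bar>) powr r"
      using e[OF that] p pr by (intro powr_mono2) auto
    also have "\<dots> = 3 powr r * (min \<delta> \<bar>x i\<bar> powr (r - p) * min \<delta> \<bar>x i\<bar> powr p)"
      using \<delta> by (simp add: powr_mult flip: powr_add)
    also have "\<dots> \<le> 3 powr r * (\<delta> powr (r - p) * \<bar>x i\<bar> powr p)"
      using \<delta> p pr by (intro mult_left_mono mult_mono powr_mono2) auto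
    finally show ?thesis by simp
  qed
  have "(\<Sum>i<m. \<bar>e i\<bar> powr r) \<le> (\<Sum>i<m. 3 powr r * \<delta> powr (r - p) * \<bar>x i\<bar> powr p)"
    using t by (intro sum_mono) auto
  also have "\<dots> = 3 powr r * \<delta> powr (r - p) * (\<Sum>i<m. \<bar>x i\<bar> powr p)"
    by (simp add: sum_distrib_left)
  also have "\<dots> \<le> 3 powr r * \<delta> powr (r - p) * 1"
    using lp_norm_le_one_imp(1)[OF p x] by (intro mult_left_mono) auto
  finally have "(\<Sum>i<m. \<bar>e i\<bar> powr r) powr (1 / r) \<le> (3 powr r * \<delta> powr (r - p)) powr (1 / r)"
    using p pr by (intro powr_mono2) (auto intro: sum_nonneg)
  also have "\<dots> = 3 * \<delta> powr ((r - p) / r)"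
    using p pr by (simp add: powr_mult powr_powr)
  also have "(r - p) / r = 1 - p / r" using p pr by (simp add: field_simps)
  finally show ?thesis using r p pr by (simp add: lp_norm_def)
qed

text \<open>
  The inequality between the quadratic and the \<open>p\<close>-th power mean.  It loses the factor
  \<open>m powr (1 - 2 / p)\<close> that distinguishes the rates for \<open>p > 2\<close>.
\<close>

lemma sum_squares_le_of_power_sum:
  fixes p :: real
  assumes p: "2 < p" and m: "0 < m" and s: "(\<Sum>i<m. \<bar>x i\<bar> powr p) \<le> 1"
  shows "(\<Sum>i<m. (x i)\<^sup>2) \<le> real m powr (1 - 2 / p)"
proof -
  \<comment> \<open>Young's inequality for each entry, scaled to be sharp if all entries have modulus \<open>c\<close>.\<close>
  define c where "c = real m powr (- 1 / p)"
  have c: "0 < c" using m by (simp add: c_def)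
  have cp: "c powr p = 1 / real m" unfolding c_def powr_powr using p m by (simp add: powr_minus_divide)
  have c2: "c\<^sup>2 = real m powr (- 2 / p)"
    using p m powr_numeral[of c "num.Bit0 num.One"] c unfolding c_def by (simp add: powr_powr)
  have t: "(x i)\<^sup>2 \<le> c\<^sup>2 * (2 / p * (\<bar>x i\<bar> powr p * real m) + (1 - 2 / p))" if "i < m" for i
  proof -
    define u where "u = \<bar>x i\<bar> / c"
    have "u\<^sup>2 \<le> 2 / p * u powr p + (1 - 2 / p)"
    proof (cases "u = 0")
      case True
      then show ?thesis using p by simp
    next
      case False
      then have u: "0 < u" using c by (simp add: u_def)
      have "(u powr p) powr (2 / p) * 1 powr (1 - 2 / p) \<le> 2 / p * u powr p + (1 - 2 / p) * 1"
        using p u by (intro Youngs_inequality_0) auto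
      then show ?thesis using p u by (simp add: powr_powr)
    qed
    moreover have "u powr p = \<bar>x i\<bar> powr p * real m"
      using c by (simp add: u_def powr_divide cp)
    moreover have "(x i)\<^sup>2 = c\<^sup>2 * u\<^sup>2"
      using c by (simp add: u_def power_divide)
    ultimately show ?thesis using c by simp
  qed
  have "(\<Sum>i<m. (x i)\<^sup>2) \<le> (\<Sum>i<m. c\<^sup>2 * (2 / p * (\<bar>x i\<bar> powr p * real m) + (1 - 2 / p)))"
    using t by (intro sum_mono) auto
  also have "\<dots> = c\<^sup>2 * (2 / p * real m * (\<Sum>i<m. \<bar>x i\<bar> powr p) + real m * (1 - 2 / p))"
    unfolding sum_distrib_left[symmetric] sum.distrib
    by (simp add: sum_distrib_left sum_divide_distrib mult_ac)
  also have "\<dots> \<le> c\<^sup>2 * (2 / p * real m * 1 + real m * (1 - 2 / p))"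
    using p s by (intro mult_left_mono add_mono) auto
  also have "\<dots> = c\<^sup>2 * real m" using p by (simp add: field_simps)
  also have "\<dots> = real m powr (1 - 2 / p)"
    unfolding c2 using m by (simp add: powr_diff powr_minus field_simps)
  finally show ?thesis .
qed

text \<open>
  The largest value that \<open>\<Sum>i<m. \<bar>x i\<bar> powr min p 2\<close> can take on the unit ball of
  \<open>\<ell>\<^sub>p\<close>.
\<close>

definition width :: "real \<Rightarrow> nat \<Rightarrow> real" where
  "width p m = (if p \<le> 2 then 1 else real m powr (1 - 2 / p))"

lemma one_le_width: "1 \<le> p \<Longrightarrow> 0 < m \<Longrightarrow> 1 \<le> width p m"
  by (simp add: width_def ge_one_powr_ge_zero)

text \<open>
  For \<open>p \<le> 2\<close>, \<open>u\<^sup>2 \<le> u powr p\<close> for \<open>u = min 1 (\<bar>x i\<bar> / \<tau>) \<le> 1\<close>; for \<open>p > 2\<close>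
  the truncation is dropped.
\<close>

lemma sum_truncated_squares:
  fixes p :: real
  assumes p: "1 \<le> p" and m: "0 < m" and \<tau>: "0 < \<tau>" and x: "lp_norm (ereal p) m x \<le> 1"
  shows "(\<Sum>i<m. (min 1 (\<bar>x i\<bar> / \<tau>))\<^sup>2) \<le> width p m / \<tau> powr min p 2"
proof (cases "p \<le> 2")
  case True
  have "(min 1 (\<bar>x i\<bar> / \<tau>))\<^sup>2 \<le> \<bar>x i\<bar> powr p / \<tau> powr p" for i
  proof (cases "x i = 0")
    case False
    define u where "u = min 1 (\<bar>x i\<bar> / \<tau>)"
    have u: "0 < u" "u \<le> 1" "u \<le> \<bar>x i\<bar> / \<tau>" using False \<tau> by (auto simp: u_def)
    have "u\<^sup>2 = u powr 2" using u by simp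
    also have "\<dots> \<le> u powr p" using u True by (intro powr_mono') auto
    also have "\<dots> \<le> (\<bar>x i\<bar> / \<tau>) powr p" using u p by (intro powr_mono2) auto
    finally show ?thesis using \<tau> by (simp add: u_def powr_divide)
  qed simp
  then have "(\<Sum>i<m. (min 1 (\<bar>x i\<bar> / \<tau>))\<^sup>2) \<le> (\<Sum>i<m. \<bar>x i\<bar> powr p / \<tau> powr p)"
    by (rule sum_mono)
  also have "\<dots> \<le> 1 / \<tau> powr p"
    unfolding sum_divide_distrib[symmetric]
    using lp_norm_le_one_imp[OF p x] \<tau> by (intro divide_right_mono) auto
  finally show ?thesis using True by (simp add: width_def)
next
  case False
  have "(min 1 (\<bar>x i\<bar> / \<tau>))\<^sup>2 \<le> (x i)\<^sup>2 / \<tau>\<^sup>2" for i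
  proof -
    have "(min 1 (\<bar>x i\<bar> / \<tau>))\<^sup>2 \<le> (\<bar>x i\<bar> / \<tau>)\<^sup>2" using \<tau> by (intro power_mono) auto
    then show ?thesis by (simp add: power_divide)
  qed
  then have "(\<Sum>i<m. (min 1 (\<bar>x i\<bar> / \<tau>))\<^sup>2) \<le> (\<Sum>i<m. (x i)\<^sup>2 / \<tau>\<^sup>2)"
    by (rule sum_mono)
  also have "\<dots> \<le> real m powr (1 - 2 / p) / \<tau>\<^sup>2"
    unfolding sum_divide_distrib[symmetric] using False m lp_norm_le_one_imp(1)[OF p x]
    by (intro divide_right_mono sum_squares_le_of_power_sum) auto
  finally show ?thesis using False \<tau> by (simp add: width_def)
qed

section \<open>Algorithms with finitely many equally likely outcomes\<close>

text \<open>
  A random matrix and decoder drawn uniformly from a finite set can be drawn on any sample type into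
  which that set embeds.  All measurability conditions hold because the sample space is discrete, so
  only the average error remains to be bounded.
\<close>

lemma uniform_finite_algorithm:
  fixes \<Omega> :: "'a set" and N :: "'a \<Rightarrow> nat \<times> nat \<Rightarrow> real"
    and \<phi> :: "'a \<Rightarrow> (nat \<Rightarrow> real) \<Rightarrow> nat \<Rightarrow> real"
  assumes fin: "finite \<Omega>" and ne: "\<Omega> \<noteq> {}" and m: "0 < m"
    and err: "\<And>x. x \<in> Rvec m \<Longrightarrow> lp_norm p m x \<le> 1 \<Longrightarrow>
      (\<Sum>\<omega>\<in>\<Omega>. lp_norm q m (\<lambda>i. x i - \<phi> \<omega> (mat_vec k m (N \<omega>) x) i)) \<le> E * real (card \<Omega>)"
  shows "\<exists>(M :: (nat \<Rightarrow> real) measure) A. nonada_alg k m M A \<and> alg_error p q m M A \<le> ennreal E"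
proof -
  obtain f :: "'a \<Rightarrow> nat" where f: "inj_on f \<Omega>"
    using finite_imp_inj_to_nat_seg[OF fin] by blast
  define F where "F = (\<lambda>\<omega> (_::nat). real (f \<omega>))"
  have F: "inj_on F \<Omega>"
    using f by (auto simp: F_def inj_on_def fun_eq_iff)
  define G where "G = inv_into \<Omega> F"
  define P where "P = map_pmf F (pmf_of_set \<Omega>)"
  define N' where "N' = (\<lambda>w. restrict (N (G w)) ({..<k} \<times> {..<m}))"
  define \<phi>' where "\<phi>' = (\<lambda>w y. restrict (\<phi> (G w) y) {..<m})"
  define A where "A = (\<lambda>w x. \<phi>' w (mat_vec k m (N' w) x))"
  have mv: "mat_vec k m (N' w) x = mat_vec k m (N (G w)) x" for w x
    by (auto simp: mat_vec_def N'_def fun_eq_iff)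
  have alg: "nonada_alg k m (measure_pmf P) A"
    unfolding nonada_alg_def
  proof (intro conjI exI[of _ N'] exI[of _ \<phi>'])
    show "N' \<in> measure_pmf P \<rightarrow>\<^sub>M mat_space k m"
      by (auto simp: mat_space_def space_PiM N'_def)
    show "\<forall>\<omega>\<in>space (measure_pmf P). \<phi>' \<omega> \<in> Rvec k \<rightarrow> Rvec m"
      by (auto simp: \<phi>'_def)
    show "\<forall>x\<in>Rvec m. (\<lambda>\<omega>. A \<omega> x) \<in> measure_pmf P \<rightarrow>\<^sub>M vec_space m"
      by (auto simp: vec_space_def space_PiM A_def \<phi>'_def)
  qed (auto simp: A_def measure_pmf.prob_space_axioms)
  have "alg_error p q m (measure_pmf P) A \<le> ennreal E"
    unfolding alg_error_def
  proof (rule SUP_least, clarify)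
    fix x assume x: "x \<in> Rvec m" "lp_norm p m x \<le> 1"
    let ?L = "\<lambda>\<omega>. lp_norm q m (\<lambda>i. x i - \<phi> \<omega> (mat_vec k m (N \<omega>) x) i)"
    have L: "lp_norm q m (\<lambda>i. x i - A w x i) = ?L (G w)" for w
      unfolding A_def mv by (rule lp_norm_cong) (simp add: \<phi>'_def)
    have c: "0 < real (card \<Omega>)" using fin ne by (simp add: card_gt_0_iff)
    have "(\<integral>\<^sup>+ w. ennreal (lp_norm q m (\<lambda>i. x i - A w x i)) \<partial>measure_pmf P) =
        (\<integral>\<^sup>+ \<omega>. ennreal (?L (G (F \<omega>))) \<partial>measure_pmf (pmf_of_set \<Omega>))"
      unfolding P_def by (simp add: L)
    also have "\<dots> = (\<Sum>\<omega>\<in>\<Omega>. ennreal (?L (G (F \<omega>)))) / of_nat (card \<Omega>)"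
      using fin ne by (simp add: nn_integral_pmf_of_set)
    also have "(\<Sum>\<omega>\<in>\<Omega>. ennreal (?L (G (F \<omega>)))) = (\<Sum>\<omega>\<in>\<Omega>. ennreal (?L \<omega>))"
      by (intro sum.cong) (auto simp: G_def inv_into_f_f[OF F])
    also have "\<dots> = ennreal (\<Sum>\<omega>\<in>\<Omega>. ?L \<omega>)"
      by (simp add: lp_norm_nonneg[OF m])
    also have "\<dots> / of_nat (card \<Omega>) \<le> ennreal (E * real (card \<Omega>)) / of_nat (card \<Omega>)"
      by (intro divide_right_mono_ennreal ennreal_leI err x)
    also have "\<dots> = ennreal E"
    proof (cases "0 \<le> E")
      case True
      have "ennreal (E * real (card \<Omega>)) / ennreal (real (card \<Omega>)) = ennreal E"
        using True c by (subst divide_ennreal) auto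
      then show ?thesis by (simp add: ennreal_of_nat_eq_real_of_nat)
    next
      case False
      then have "E * real (card \<Omega>) \<le> 0" using c by (simp add: mult_le_0_iff)
      then show ?thesis using False by (simp add: ennreal_neg)
    qed
    finally show "(\<integral>\<^sup>+ w. ennreal (lp_norm q m (\<lambda>i. x i - A w x i)) \<partial>measure_pmf P) \<le> ennreal E" .
  qed
  with alg show ?thesis by blast
qed

section \<open>Sums over random signs and random hash functions\<close>

text \<open>
  Independence of the coordinates of a uniformly random function, in counting form.
\<close>

lemma sum_PiE_prod_subset:
  fixes g :: "'i \<Rightarrow> 'b \<Rightarrow> real"
  assumes I: "finite I" and J: "J \<subseteq> I" and S: "finite S"
  shows "(\<Sum>f\<in>I \<rightarrow>\<^sub>E S. \<Prod>l\<in>J. g l (f l)) =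
    real (card S) ^ (card I - card J) * (\<Prod>l\<in>J. \<Sum>b\<in>S. g l b)"
proof -
  have "(\<Prod>l\<in>J. g l (f l)) = (\<Prod>l\<in>I. if l \<in> J then g l (f l) else 1)" for f
    using I J by (simp add: prod.If_cases Int_absorb1)
  then have "(\<Sum>f\<in>I \<rightarrow>\<^sub>E S. \<Prod>l\<in>J. g l (f l)) =
      (\<Sum>f\<in>I \<rightarrow>\<^sub>E S. \<Prod>l\<in>I. if l \<in> J then g l (f l) else 1)"
    by simp
  also have "\<dots> = (\<Prod>l\<in>I. \<Sum>b\<in>S. if l \<in> J then g l b else 1)"
    using prod_sum_PiE[of I "\<lambda>_. S" "\<lambda>l b. if l \<in> J then g l b else 1"] I S by simp
  also have "\<dots> = (\<Prod>l\<in>I. if l \<in> J then \<Sum>b\<in>S. g l b else real (card S))"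
    by (intro prod.cong) auto
  also have "\<dots> = (\<Prod>l\<in>J. \<Sum>b\<in>S. g l b) * real (card S) ^ card (I - J)"
    using I J by (simp add: prod.If_cases Int_absorb1 Diff_eq)
  finally show ?thesis using I J by (simp add: card_Diff_subset finite_subset mult.commute)
qed

text \<open>
  Distinct random signs are uncorrelated, so only the diagonal terms of the square survive.
\<close>

lemma sum_signs_square:
  fixes c :: "'i \<Rightarrow> real"
  assumes I: "finite I" and J: "J \<subseteq> I"
  shows "(\<Sum>\<sigma>\<in>I \<rightarrow>\<^sub>E {-1, 1}. (\<Sum>i\<in>J. \<sigma> i * c i)\<^sup>2) = 2 ^ card I * (\<Sum>i\<in>J. (c i)\<^sup>2)"
proof -
  let ?S = "I \<rightarrow>\<^sub>E {-1, 1 :: real}"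
  have finJ: "finite J" using I J finite_subset by blast
  have pair: "(\<Sum>\<sigma>\<in>?S. \<sigma> i * \<sigma> k) = (if i = k then 2 ^ card I else 0)"
    if "i \<in> J" "k \<in> J" for i k
  proof (cases "i = k")
    case True
    have "(\<Sum>\<sigma>\<in>?S. \<sigma> i * \<sigma> k) = (\<Sum>\<sigma>\<in>?S. 1)"
      using that J True by (intro sum.cong) (fastforce simp: PiE_iff)+
    then show ?thesis using True I by (simp add: card_PiE)
  next
    case False
    then show ?thesis
      using sum_PiE_prod_subset[of I "{i, k}" "{-1, 1 :: real}" "\<lambda>_ b. b"] I J that by auto
  qed
  have "(\<Sum>\<sigma>\<in>?S. (\<Sum>i\<in>J. \<sigma> i * c i)\<^sup>2) =
      (\<Sum>\<sigma>\<in>?S. \<Sum>i\<in>J. \<Sum>k\<in>J. c i * c k * (\<sigma> i * \<sigma> k))"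
    by (simp add: power2_eq_square sum_product mult_ac)
  also have "\<dots> = (\<Sum>i\<in>J. \<Sum>k\<in>J. \<Sum>\<sigma>\<in>?S. c i * c k * (\<sigma> i * \<sigma> k))"
    by (subst sum.swap, intro sum.cong refl, subst sum.swap) simp
  also have "\<dots> = (\<Sum>i\<in>J. \<Sum>k\<in>J. c i * c k * (if i = k then 2 ^ card I else 0))"
    by (intro sum.cong refl) (simp only: sum_distrib_left[symmetric] pair)
  also have "\<dots> = (\<Sum>i\<in>J. c i * c i * 2 ^ card I)"
    using finJ by (intro sum.cong refl) (simp add: if_distrib cong: if_cong)
  finally show ?thesis by (simp add: sum_distrib_left power2_eq_square mult_ac)
qed

lemma card_hash_collision:
  assumes I: "finite I" and ij: "i \<in> I" "j \<in> I" "i \<noteq> j"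
  shows "real B * real (card {h \<in> I \<rightarrow>\<^sub>E {..<B}. h i = h j}) = real (card (I \<rightarrow>\<^sub>E {..<B}))"
proof -
  let ?H = "I \<rightarrow>\<^sub>E {..<B}"
  have finH: "finite ?H" using I by (simp add: finite_PiE)
  \<comment> \<open>Splitting by the common bucket \<open>g\<close> turns the collision into a product over \<open>{i, j}\<close>.\<close>
  have "real (card {h \<in> ?H. h i = h j}) = (\<Sum>h\<in>?H. if h i = h j then 1 else 0)"
    using finH by (simp add: sum.If_cases Int_def)
  also have "\<dots> = (\<Sum>h\<in>?H. \<Sum>g<B. \<Prod>l\<in>{i, j}. if h l = g then 1 else 0)"
  proof (intro sum.cong refl)
    fix h assume h: "h \<in> ?H"
    have "(\<Sum>g<B. \<Prod>l\<in>{i, j}. if h l = g then 1 else 0 :: real) =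
        (\<Sum>g<B. if h i = g then if h i = h j then 1 else 0 else 0)"
      using ij by (intro sum.cong) auto
    then show "(if h i = h j then 1 else 0) = (\<Sum>g<B. \<Prod>l\<in>{i, j}. if h l = g then 1 else 0 :: real)"
      using h ij by (auto simp: PiE_iff)
  qed
  also have "\<dots> = (\<Sum>g<B. \<Sum>h\<in>?H. \<Prod>l\<in>{i, j}. if h l = g then 1 else 0)"
    by (rule sum.swap)
  also have "\<dots> = (\<Sum>g<B. real B ^ (card I - 2))"
  proof (intro sum.cong refl)
    fix g assume "g \<in> {..<B}"
    then show "(\<Sum>h\<in>?H. \<Prod>l\<in>{i, j}. if h l = g then 1 else 0) = real B ^ (card I - 2)"
      using sum_PiE_prod_subset[of I "{i, j}" "{..<B}" "\<lambda>_ b. if b = g then 1 else 0"] I ij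
      by (simp add: numeral_2_eq_2)
  qed
  finally have *: "real (card {h \<in> ?H. h i = h j}) = real B * real B ^ (card I - 2)" by simp
  have "2 \<le> card I"
    using card_mono[of I "{i, j}"] I ij by simp
  then obtain d where "card I = 2 + d" using le_Suc_ex by blast
  then show ?thesis using I * by (simp add: card_PiE power_add power2_eq_square)
qed

section \<open>One repetition of the sketch\<close>

text \<open>
  The outcomes of one repetition: a hash function into \<open>B\<close> buckets and a sign for every coordinate.
\<close>

definition row_space :: "nat \<Rightarrow> nat \<Rightarrow> ((nat \<Rightarrow> nat) \<times> (nat \<Rightarrow> real)) set" where
  "row_space m B = ({..<m} \<rightarrow>\<^sub>E {..<B}) \<times> ({..<m} \<rightarrow>\<^sub>E {-1, 1})"

text \<open>
  What the other coordinates add to the bucket of \<open>j\<close>.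
\<close>

definition noise :: "nat \<Rightarrow> (nat \<Rightarrow> nat) \<times> (nat \<Rightarrow> real) \<Rightarrow> (nat \<Rightarrow> real) \<Rightarrow> nat \<Rightarrow> real" where
  "noise m \<rho> x j = (\<Sum>i\<in>{..<m} - {j}. if fst \<rho> i = fst \<rho> j then snd \<rho> i * x i else 0)"

lemma finite_row_space: "finite (row_space m B)"
  by (simp add: row_space_def finite_PiE)

lemma row_space_nonempty: "0 < B \<Longrightarrow> row_space m B \<noteq> {}"
  by (auto simp: row_space_def PiE_eq_empty_iff)

text \<open>
  For the noise to exceed \<open>\<tau>\<close>, either an entry larger than \<open>\<tau>\<close> collides with \<open>j\<close>, or the
  square of the noise of the other entries exceeds \<open>\<tau>\<^sup>2\<close>.  By Markov's inequality the
  probabilities of these events are bounded by the expected number of colliding large entries and by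
  the second moment of the remaining noise, divided by \<open>\<tau>\<^sup>2\<close>.  An entry \<open>i \<noteq> j\<close>
  contributes \<open>(min 1 (\<bar>x i\<bar> / \<tau>))\<^sup>2 / B\<close> to the sum of both, whether it is large or small.
\<close>

lemma card_noisy_rows:
  assumes B: "0 < B" and \<tau>: "0 < \<tau>" and j: "j < m"
    and sparse: "(\<Sum>i<m. (min 1 (\<bar>x i\<bar> / \<tau>))\<^sup>2) \<le> real B / 16"
  shows "16 * real (card {\<rho> \<in> row_space m B. \<tau> < \<bar>noise m \<rho> x j\<bar>}) \<le> real (card (row_space m B))"
proof -
  let ?I = "{..<m}"
  let ?H = "?I \<rightarrow>\<^sub>E {..<B}" and ?S = "?I \<rightarrow>\<^sub>E {-1, 1 :: real}"
  define hv where "hv = {i \<in> ?I - {j}. \<tau> < \<bar>x i\<bar>}"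
  define lt where "lt = {i \<in> ?I - {j}. \<bar>x i\<bar> \<le> \<tau>}"
  define w where "w = (\<lambda>i. (min 1 (\<bar>x i\<bar> / \<tau>))\<^sup>2)"
  define hit where "hit = (\<lambda>(h :: nat \<Rightarrow> nat) i. if h i = h j then 1 else 0 :: real)"
  have fin: "finite hv" "finite lt" "finite ?H" "finite ?S"
    by (auto simp: hv_def lt_def finite_PiE)
  have split: "?I - {j} = hv \<union> lt" "hv \<inter> lt = {}" by (auto simp: hv_def lt_def)
  have whv: "w i = 1" if "i \<in> hv" for i
    using that \<tau> by (auto simp: w_def hv_def min_def field_simps)
  have wlt: "(x i)\<^sup>2 = \<tau>\<^sup>2 * w i" if "i \<in> lt" for i
  proof -
    have "min 1 (\<bar>x i\<bar> / \<tau>) = \<bar>x i\<bar> / \<tau>"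
      using that \<tau> by (auto simp: lt_def min_def field_simps)
    then show ?thesis using \<tau> by (simp add: w_def power_divide)
  qed
  \<comment> \<open>The quantity whose average is computed in place of the probability.\<close>
  let ?q = "\<lambda>h \<sigma>. (\<Sum>i\<in>hv. hit h i) + (\<Sum>i\<in>lt. \<sigma> i * (hit h i * x i))\<^sup>2 / \<tau>\<^sup>2"
  have point: "(if \<tau> < \<bar>noise m (h, \<sigma>) x j\<bar> then 1 else 0) \<le> ?q h \<sigma>" for h \<sigma>
  proof (cases "\<tau> < \<bar>noise m (h, \<sigma>) x j\<bar>")
    case True
    have nn: "0 \<le> (\<Sum>i\<in>hv. hit h i)" "0 \<le> (\<Sum>i\<in>lt. \<sigma> i * (hit h i * x i))\<^sup>2 / \<tau>\<^sup>2"
      by (auto simp: hit_def intro: sum_nonneg)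
    have n: "noise m (h, \<sigma>) x j = (\<Sum>i\<in>hv. \<sigma> i * (hit h i * x i)) + (\<Sum>i\<in>lt. \<sigma> i * (hit h i * x i))"
    proof -
      have "noise m (h, \<sigma>) x j = (\<Sum>i\<in>hv \<union> lt. \<sigma> i * (hit h i * x i))"
        unfolding noise_def split(1) by (intro sum.cong) (auto simp: hit_def)
      then show ?thesis using fin split by (simp add: sum.union_disjoint)
    qed
    show ?thesis
    proof (cases "\<exists>i\<in>hv. h i = h j")
      case ex: True
      then obtain i where i: "i \<in> hv" "h i = h j" by blast
      have "hit h i \<le> (\<Sum>i\<in>hv. hit h i)"
        using i fin by (intro member_le_sum) (auto simp: hit_def)
      moreover have "hit h i = 1" using i by (simp add: hit_def)
      ultimately show ?thesis unfolding if_P[OF True] using nn by linarith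
    next
      case False
      then have "(\<Sum>i\<in>hv. \<sigma> i * (hit h i * x i)) = 0"
        by (intro sum.neutral) (auto simp: hit_def)
      then have "\<tau> < \<bar>\<Sum>i\<in>lt. \<sigma> i * (hit h i * x i)\<bar>" using True n by simp
      then have "\<tau>\<^sup>2 < (\<Sum>i\<in>lt. \<sigma> i * (hit h i * x i))\<^sup>2"
        using \<tau> by (metis abs_of_pos power2_abs abs_le_square_iff not_less)
      then have "1 \<le> (\<Sum>i\<in>lt. \<sigma> i * (hit h i * x i))\<^sup>2 / \<tau>\<^sup>2"
        using \<tau> by simp
      then show ?thesis using True nn by simp
    qed
  next
    case False
    then show ?thesis by (auto simp: hit_def intro!: add_nonneg_nonneg sum_nonneg)
  qed
  have hits: "real B * (\<Sum>h\<in>?H. hit h i) = real (card ?H)" if "i \<in> ?I - {j}" for i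
  proof -
    have "(\<Sum>h\<in>?H. hit h i) = real (card {h \<in> ?H. h i = h j})"
      using fin(3) by (simp add: hit_def sum.If_cases Int_def)
    then show ?thesis using card_hash_collision[of ?I i j B] that j by simp
  qed
  have "real (card {\<rho> \<in> row_space m B. \<tau> < \<bar>noise m \<rho> x j\<bar>}) =
      (\<Sum>\<rho>\<in>row_space m B. if \<tau> < \<bar>noise m \<rho> x j\<bar> then 1 else 0)"
    using finite_row_space by (simp add: sum.If_cases Int_def)
  also have "\<dots> = (\<Sum>h\<in>?H. \<Sum>\<sigma>\<in>?S. if \<tau> < \<bar>noise m (h, \<sigma>) x j\<bar> then 1 else 0)"
    by (simp add: row_space_def sum.cartesian_product split_def)
  also have "\<dots> \<le> (\<Sum>h\<in>?H. \<Sum>\<sigma>\<in>?S. ?q h \<sigma>)"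
    by (intro sum_mono point)
  also have "\<dots> = (\<Sum>h\<in>?H. 2 ^ m * (\<Sum>i\<in>?I - {j}. hit h i * w i))"
  proof (intro sum.cong refl)
    fix h
    have "(\<Sum>\<sigma>\<in>?S. ?q h \<sigma>) = 2 ^ m * (\<Sum>i\<in>hv. hit h i) +
        (\<Sum>\<sigma>\<in>?S. (\<Sum>i\<in>lt. \<sigma> i * (hit h i * x i))\<^sup>2) / \<tau>\<^sup>2"
      by (simp add: sum.distrib card_PiE sum_divide_distrib)
    also have "(\<Sum>\<sigma>\<in>?S. (\<Sum>i\<in>lt. \<sigma> i * (hit h i * x i))\<^sup>2) = 2 ^ m * (\<Sum>i\<in>lt. (hit h i * x i)\<^sup>2)"
      by (subst sum_signs_square) (auto simp: lt_def)
    also have "(\<Sum>i\<in>lt. (hit h i * x i)\<^sup>2) = \<tau>\<^sup>2 * (\<Sum>i\<in>lt. hit h i * w i)"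
      unfolding sum_distrib_left by (intro sum.cong) (auto simp: hit_def wlt)
    moreover have "(\<Sum>i\<in>hv. hit h i) = (\<Sum>i\<in>hv. hit h i * w i)"
      by (intro sum.cong) (auto simp: whv)
    ultimately show "(\<Sum>\<sigma>\<in>?S. ?q h \<sigma>) = 2 ^ m * (\<Sum>i\<in>?I - {j}. hit h i * w i)"
      using fin split \<tau> by (simp add: sum.union_disjoint distrib_left)
  qed
  also have "\<dots> = 2 ^ m * (\<Sum>i\<in>?I - {j}. w i * (\<Sum>h\<in>?H. hit h i))"
    unfolding sum_distrib_left[symmetric]
    by (subst sum.swap) (simp add: sum_distrib_left mult.commute)
  finally have "real B * real (card {\<rho> \<in> row_space m B. \<tau> < \<bar>noise m \<rho> x j\<bar>}) \<le>
      real B * (2 ^ m * (\<Sum>i\<in>?I - {j}. w i * (\<Sum>h\<in>?H. hit h i)))"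
    by (intro mult_left_mono) auto
  also have "\<dots> = 2 ^ m * (\<Sum>i\<in>?I - {j}. w i * (real B * (\<Sum>h\<in>?H. hit h i)))"
    by (simp add: sum_distrib_left mult_ac)
  also have "\<dots> = 2 ^ m * (\<Sum>i\<in>?I - {j}. w i * real (card ?H))"
    using hits by (intro arg_cong2[of _ _ _ _ "(*)"] sum.cong) auto
  also have "\<dots> = real (card (row_space m B)) * (\<Sum>i\<in>?I - {j}. w i)"
    by (simp add: row_space_def card_cartesian_product card_PiE sum_distrib_right[symmetric])
  also have "\<dots> \<le> real (card (row_space m B)) * (\<Sum>i<m. w i)"
    by (intro mult_left_mono sum_mono2) (auto simp: w_def)
  also have "\<dots> \<le> real (card (row_space m B)) * (real B / 16)"
    using sparse by (intro mult_left_mono) (auto simp: w_def)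
  finally show ?thesis using B by simp
qed

text \<open>
  The measurement \<open>r * B + g\<close> is the signed content of the bucket \<open>g\<close> in the repetition \<open>r\<close>.
\<close>

definition sketch_matrix ::
  "nat \<Rightarrow> (nat \<Rightarrow> (nat \<Rightarrow> nat) \<times> (nat \<Rightarrow> real)) \<Rightarrow> nat \<times> nat \<Rightarrow> real" where
  "sketch_matrix B \<omega> = (\<lambda>(l, j). if fst (\<omega> (l div B)) j = l mod B then snd (\<omega> (l div B)) j else 0)"

definition estimate ::
  "nat \<Rightarrow> (nat \<Rightarrow> (nat \<Rightarrow> nat) \<times> (nat \<Rightarrow> real)) \<Rightarrow> (nat \<Rightarrow> real) \<Rightarrow> nat \<Rightarrow> nat \<Rightarrow> real" where
  "estimate B \<omega> y j r = snd (\<omega> r) j * y (r * B + fst (\<omega> r) j)"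

text \<open>
  The sign of \<open>j\<close> squares to \<open>1\<close>, so multiplying the bucket by it isolates \<open>x j\<close>.
\<close>

lemma estimate_eq:
  assumes \<omega>: "\<omega> r \<in> row_space m B" and r: "r < R" and j: "j < m"
  shows "estimate B \<omega> (mat_vec (R * B) m (sketch_matrix B \<omega>) x) j r =
    x j + snd (\<omega> r) j * noise m (\<omega> r) x j"
proof -
  obtain h \<sigma> where hs: "\<omega> r = (h, \<sigma>)" by (cases "\<omega> r")
  have h: "h j < B" and "\<sigma> j = -1 \<or> \<sigma> j = 1"
    using \<omega> j hs by (auto simp: row_space_def PiE_iff)
  then have \<sigma>: "\<sigma> j * \<sigma> j = 1" by auto
  have "r * B + h j < Suc r * B" using h by simp
  also have "\<dots> \<le> R * B" using r by (intro mult_right_mono) auto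
  finally have "r * B + h j < R * B" .
  then have "mat_vec (R * B) m (sketch_matrix B \<omega>) x (r * B + h j) =
      (\<Sum>i<m. if h i = h j then \<sigma> i * x i else 0)"
    using h by (simp add: mat_vec_def sketch_matrix_def hs if_distrib[of "\<lambda>t. t * _"] cong: if_cong)
  also have "\<dots> = \<sigma> j * x j + noise m (h, \<sigma>) x j"
    using j by (simp add: noise_def sum.remove[of _ j] cong: if_cong)
  finally show ?thesis
    using \<sigma> by (simp add: estimate_def hs distrib_left flip: mult.assoc)
qed

section \<open>Majority vote and thresholding\<close>

text \<open>
  An exponential Markov inequality: if the number \<open>b\<close> of bad repetitions satisfies \<open>R \<le> 2 * b\<close>,
  then \<open>1 \<le> 16 ^ b / 4 ^ R\<close>.  By independence the mean of \<open>16 ^ b\<close> is the \<open>R\<close>-th power of a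
  mean that is at most \<open>1 + 15 / 16 \<le> 2\<close>, which leaves \<open>2 ^ R / 4 ^ R\<close>.
\<close>

lemma card_majority_bad:
  assumes S: "finite S" and bad: "16 * real (card {s \<in> S. P s}) \<le> real (card S)"
  shows "real (card {\<omega> \<in> {..<R} \<rightarrow>\<^sub>E S. R \<le> 2 * card {r. r < R \<and> P (\<omega> r)}}) \<le>
    real (card ({..<R} \<rightarrow>\<^sub>E S)) / 2 ^ R"
proof -
  let ?O = "{..<R} \<rightarrow>\<^sub>E S"
  let ?f = "\<lambda>s. if P s then 16 else 1 :: real"
  have fin: "finite ?O" using S by (simp add: finite_PiE)
  have pr: "(\<Prod>r<R. ?f (\<omega> r)) = 16 ^ card {r. r < R \<and> P (\<omega> r)}" for \<omega>
    by (simp add: prod.If_cases Int_def lessThan_def)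
  have "(\<Sum>s\<in>S. ?f s) = real (card S) + 15 * real (card {s \<in> S. P s})"
  proof -
    have "(\<Sum>s\<in>S. ?f s) = (\<Sum>s\<in>S. 1 + 15 * (if P s then 1 else 0))"
      by (intro sum.cong) auto
    also have "\<dots> = real (card S) + 15 * (\<Sum>s\<in>S. if P s then 1 else 0)"
      by (simp only: sum.distrib sum_distrib_left[symmetric]) simp
    finally show ?thesis using S by (simp add: sum.If_cases Int_def)
  qed
  then have s2: "(\<Sum>s\<in>S. ?f s) \<le> 2 * real (card S)" using bad by simp
  have "real (card {\<omega> \<in> ?O. R \<le> 2 * card {r. r < R \<and> P (\<omega> r)}}) =
      (\<Sum>\<omega>\<in>?O. if R \<le> 2 * card {r. r < R \<and> P (\<omega> r)} then 1 else 0)"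
    using fin by (simp add: sum.If_cases Int_def)
  also have "\<dots> \<le> (\<Sum>\<omega>\<in>?O. (\<Prod>r<R. ?f (\<omega> r)) / 4 ^ R)"
  proof (intro sum_mono)
    fix \<omega>
    have "(4::real) ^ R \<le> 16 ^ card {r. r < R \<and> P (\<omega> r)}"
      if "R \<le> 2 * card {r. r < R \<and> P (\<omega> r)}"
      using power_increasing[OF that, of "4::real"] by (simp add: power_mult)
    then show "(if R \<le> 2 * card {r. r < R \<and> P (\<omega> r)} then 1 else 0) \<le> (\<Prod>r<R. ?f (\<omega> r)) / 4 ^ R"
      unfolding pr by simp
  qed
  also have "\<dots> = (\<Sum>\<omega>\<in>?O. \<Prod>r<R. ?f (\<omega> r)) / 4 ^ R"
    by (simp add: sum_divide_distrib)
  also have "(\<Sum>\<omega>\<in>?O. \<Prod>r<R. ?f (\<omega> r)) = (\<Prod>r<R. \<Sum>s\<in>S. ?f s)"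
    using prod_sum_PiE[of "{..<R}" "\<lambda>_. S" "\<lambda>_. ?f"] S by simp
  also have "\<dots> = (\<Sum>s\<in>S. ?f s) ^ R" by simp
  also have "(\<Sum>s\<in>S. ?f s) ^ R / 4 ^ R \<le> (2 * real (card S)) ^ R / 4 ^ R"
    using s2 by (intro divide_right_mono power_mono sum_nonneg) auto
  also have "\<dots> = real (card ?O) / 2 ^ R"
  proof -
    have "(4::real) ^ R = 2 ^ R * 2 ^ R" by (simp flip: power_mult_distrib)
    then show ?thesis by (simp add: card_PiE power_mult_distrib)
  qed
  finally show ?thesis .
qed

definition consensus :: "nat \<Rightarrow> real \<Rightarrow> (nat \<Rightarrow> real) \<Rightarrow> real \<Rightarrow> bool" where
  "consensus R \<tau> e z \<longleftrightarrow> R < 2 * card {r. r < R \<and> \<bar>e r - z\<bar> \<le> \<tau>}"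

text \<open>
  Two majorities have a common element.
\<close>

lemma consensus_close:
  assumes "consensus R \<tau> e u" "consensus R \<tau> e v"
  shows "\<bar>u - v\<bar> \<le> 2 * \<tau>"
proof -
  let ?U = "{r. r < R \<and> \<bar>e r - u\<bar> \<le> \<tau>}" and ?V = "{r. r < R \<and> \<bar>e r - v\<bar> \<le> \<tau>}"
  have "card (?U \<union> ?V) \<le> card {..<R}" by (intro card_mono) auto
  moreover have "card ?U + card ?V = card (?U \<union> ?V) + card (?U \<inter> ?V)"
    by (rule card_Un_Int) auto
  ultimately have "card (?U \<inter> ?V) \<noteq> 0"
    using assms unfolding consensus_def card_lessThan by linarith
  then have "?U \<inter> ?V \<noteq> {}" by (metis card.empty)
  then obtain r where "\<bar>e r - u\<bar> \<le> \<tau>" "\<bar>e r - v\<bar> \<le> \<tau>" by blast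
  then show ?thesis by simp
qed

text \<open>
  Any point near a majority of the estimates serves as well as their median.  It is taken from
  \<open>[-1, 1]\<close>, where the entries of the unit ball lie, so that the error stays bounded when the vote
  fails.
\<close>

definition decode_value :: "nat \<Rightarrow> real \<Rightarrow> (nat \<Rightarrow> real) \<Rightarrow> real" where
  "decode_value R \<tau> e =
     (if \<exists>z. \<bar>z\<bar> \<le> 1 \<and> consensus R \<tau> e z then SOME z. \<bar>z\<bar> \<le> 1 \<and> consensus R \<tau> e z else 0)"

text \<open>
  The threshold \<open>4 * \<tau>\<close> is twice the accuracy \<open>2 * \<tau>\<close> of a successful vote: entries of size at
  most \<open>2 * \<tau>\<close> are then sent to zero, and larger ones are lost only if they are at most
  \<open>6 * \<tau>\<close>.
\<close>

definition decode :: "nat \<Rightarrow> real \<Rightarrow> (nat \<Rightarrow> real) \<Rightarrow> real" where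
  "decode R \<tau> e = (if 4 * \<tau> < \<bar>decode_value R \<tau> e\<bar> then decode_value R \<tau> e else 0)"

lemma decode_bounded: "\<bar>decode R \<tau> e\<bar> \<le> 1"
proof -
  have "\<bar>decode_value R \<tau> e\<bar> \<le> 1"
    using someI_ex[of "\<lambda>z. \<bar>z\<bar> \<le> 1 \<and> consensus R \<tau> e z"] by (simp add: decode_value_def)
  then show ?thesis by (simp add: decode_def)
qed

lemma decode_error:
  assumes "consensus R \<tau> e t" "\<bar>t\<bar> \<le> 1"
  shows "\<bar>t - decode R \<tau> e\<bar> \<le> 3 * min (2 * \<tau>) \<bar>t\<bar>"
proof -
  have ex: "\<exists>z. \<bar>z\<bar> \<le> 1 \<and> consensus R \<tau> e z" using assms by blast
  have "consensus R \<tau> e (decode_value R \<tau> e)"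
    using someI_ex[OF ex] ex by (simp add: decode_value_def)
  then have "\<bar>t - decode_value R \<tau> e\<bar> \<le> 2 * \<tau>"
    using assms consensus_close by blast
  then show ?thesis by (auto simp: decode_def min_def)
qed

text \<open>
  The first summand is the error when the vote succeeds for all coordinates.  The second is the union
  bound over the \<open>m\<close> coordinates, each failing with probability at most \<open>1 / 2 ^ R\<close> at a cost of
  at most \<open>2 * m\<close>.
\<close>

lemma sketch_average_error:
  fixes p :: real and R :: nat
  assumes p: "1 \<le> p" and pq: "ereal p < q" and m: "0 < m"
    and B: "0 < B" and \<tau>: "0 < \<tau>"
    and x: "lp_norm (ereal p) m x \<le> 1" and x1: "\<And>i. i < m \<Longrightarrow> \<bar>x i\<bar> \<le> 1"
    and sparse: "(\<Sum>i<m. (min 1 (\<bar>x i\<bar> / \<tau>))\<^sup>2) \<le> real B / 16"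
  defines "\<Omega> \<equiv> {..<R} \<rightarrow>\<^sub>E row_space m B"
  shows "(\<Sum>\<omega>\<in>\<Omega>. lp_norm q m (\<lambda>j. x j - decode R \<tau>
            (estimate B \<omega> (mat_vec (R * B) m (sketch_matrix B \<omega>) x) j))) \<le>
    (3 * (2 * \<tau>) powr (1 - real_of_ereal (ereal p / q)) + 2 * (real m)\<^sup>2 / 2 ^ R) * real (card \<Omega>)"
proof -
  let ?e = "\<lambda>\<omega> j. estimate B \<omega> (mat_vec (R * B) m (sketch_matrix B \<omega>) x) j"
  let ?err = "\<lambda>\<omega>. lp_norm q m (\<lambda>j. x j - decode R \<tau> (?e \<omega> j))"
  let ?E = "3 * (2 * \<tau>) powr (1 - real_of_ereal (ereal p / q))"
  let ?bad = "\<lambda>j. {\<omega> \<in> \<Omega>. R \<le> 2 * card {r. r < R \<and> \<tau> < \<bar>noise m (\<omega> r) x j\<bar>}}"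
  have fin: "finite \<Omega>" by (simp add: \<Omega>_def finite_PiE finite_row_space)
  have cons: "consensus R \<tau> (?e \<omega> j) (x j)" if "\<omega> \<in> \<Omega>" "j < m" "\<omega> \<notin> ?bad j" for \<omega> j
  proof -
    have eq: "\<bar>?e \<omega> j r - x j\<bar> = \<bar>noise m (\<omega> r) x j\<bar>" if r: "r < R" for r
    proof -
      have row: "\<omega> r \<in> row_space m B" using r \<open>\<omega> \<in> \<Omega>\<close> by (auto simp: \<Omega>_def)
      then have "snd (\<omega> r) j = -1 \<or> snd (\<omega> r) j = 1"
        using \<open>j < m\<close> by (auto simp: row_space_def PiE_iff mem_Times_iff)
      then have "\<bar>snd (\<omega> r) j\<bar> = 1" by auto
      then show ?thesis using estimate_eq[where \<omega> = \<omega> and r = r, OF row r \<open>j < m\<close>] by (simp add: abs_mult)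
    qed
    have "{r. r < R \<and> \<bar>?e \<omega> j r - x j\<bar> \<le> \<tau>} = {..<R} - {r. r < R \<and> \<tau> < \<bar>noise m (\<omega> r) x j\<bar>}"
      using eq by auto
    then have "card {r. r < R \<and> \<bar>?e \<omega> j r - x j\<bar> \<le> \<tau>} = R - card {r. r < R \<and> \<tau> < \<bar>noise m (\<omega> r) x j\<bar>}"
      by (simp add: card_Diff_subset Collect_conj_eq[symmetric] subset_iff)
    then show ?thesis using that by (simp add: consensus_def)
  qed
  have point: "?err \<omega> \<le> ?E + (\<Sum>j<m. if \<omega> \<in> ?bad j then 2 * real m else 0)" if \<omega>: "\<omega> \<in> \<Omega>" for \<omega>
  proof (cases "\<exists>j<m. \<omega> \<in> ?bad j")
    case True
    then obtain j where j: "j < m" "\<omega> \<in> ?bad j" by blast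
    have "1 \<le> q" using p pq by (cases q) (auto simp: one_ereal_def)
    then have "?err \<omega> \<le> 2 * real m"
    proof (rule lp_norm_le_dimension[OF _ m])
      fix i assume "i < m"
      then show "\<bar>x i - decode R \<tau> (?e \<omega> i)\<bar> \<le> 2"
        using x1[of i] decode_bounded[of R \<tau> "?e \<omega> i"] by linarith
    qed
    also have "2 * real m = (if \<omega> \<in> ?bad j then 2 * real m else 0)" using j by simp
    also have "\<dots> \<le> (\<Sum>j<m. if \<omega> \<in> ?bad j then 2 * real m else 0)"
      using j by (intro member_le_sum) auto
    also have "\<dots> \<le> ?E + \<dots>" by simp
    finally show ?thesis .
  next
    case False
    have "?err \<omega> \<le> ?E"
      using False \<omega> \<tau> cons x1 by (intro lp_norm_le_interpolation[OF p pq m _ x] decode_error) auto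
    moreover have "0 \<le> (\<Sum>j<m. if \<omega> \<in> ?bad j then 2 * real m else 0)"
      by (intro sum_nonneg) auto
    ultimately show ?thesis by linarith
  qed
  have "(\<Sum>\<omega>\<in>\<Omega>. ?err \<omega>) \<le> (\<Sum>\<omega>\<in>\<Omega>. ?E + (\<Sum>j<m. if \<omega> \<in> ?bad j then 2 * real m else 0))"
    by (intro sum_mono point)
  also have "\<dots> = ?E * real (card \<Omega>) + (\<Sum>j<m. \<Sum>\<omega>\<in>\<Omega>. if \<omega> \<in> ?bad j then 2 * real m else 0)"
    by (subst sum.swap) (simp add: sum.distrib)
  also have "(\<Sum>j<m. \<Sum>\<omega>\<in>\<Omega>. if \<omega> \<in> ?bad j then 2 * real m else 0) = (\<Sum>j<m. 2 * real m * real (card (?bad j)))"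
    using fin by (intro sum.cong refl) (simp add: sum.If_cases Int_def)
  also have "\<dots> \<le> (\<Sum>j<m. 2 * real m * (real (card \<Omega>) / 2 ^ R))"
  proof (intro sum_mono mult_left_mono)
    fix j assume "j \<in> {..<m}"
    then show "real (card (?bad j)) \<le> real (card \<Omega>) / 2 ^ R"
      unfolding \<Omega>_def using B \<tau> sparse
      by (intro card_majority_bad finite_row_space card_noisy_rows) auto
  qed simp
  also have "\<dots> = 2 * (real m)\<^sup>2 / 2 ^ R * real (card \<Omega>)"
    by (simp add: power2_eq_square)
  finally show ?thesis by (simp add: distrib_right)
qed

section \<open>Choice of the parameters\<close>

text \<open>
  The exponent of the error bound in both ranges of \<open>p\<close>: the level \<open>\<tau>\<close> is of order
  \<open>(width p m / B) powr (1 / min p 2)\<close>, and it enters the \<open>\<ell>\<^sub>q\<close> error with the power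
  \<open>1 - p / q\<close>.
\<close>

definition rate :: "real \<Rightarrow> ereal \<Rightarrow> real" where
  "rate p q = (1 - real_of_ereal (ereal p / q)) / min p 2"

lemma exponent_bounds:
  fixes p :: real
  assumes p: "1 \<le> p" and pq: "ereal p < q"
  shows "0 < 1 - real_of_ereal (ereal p / q)" "1 - real_of_ereal (ereal p / q) \<le> 1"
    "0 < rate p q" "rate p q \<le> 1"
proof -
  show 0: "0 < 1 - real_of_ereal (ereal p / q)" and 1: "1 - real_of_ereal (ereal p / q) \<le> 1"
    using p pq by (cases q; simp)+
  show "0 < rate p q" using 0 p by (simp add: rate_def)
  have "1 \<le> min p 2" using p by simp
  with 0 1 show "rate p q \<le> 1" by (simp add: rate_def divide_le_eq)
qed

lemma powr_scale_le:
  assumes "1 \<le> c" "0 \<le> y" "0 \<le> a" "a \<le> 1"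
  shows "(c * y) powr a \<le> c * y powr (a :: real)"
proof -
  have "c powr a \<le> c powr 1" using assms by (intro powr_mono) auto
  then show ?thesis using assms by (simp add: powr_mult mult_right_mono)
qed

text \<open>
  The trivial bound by the norm of the embedding; the constant \<open>3\<close> is that of
  \<open>lp_norm_le_interpolation\<close>, used with \<open>\<delta> = 1\<close>.
\<close>

lemma zero_algorithm:
  fixes p :: real
  assumes p: "1 \<le> p" and pq: "ereal p < q" and m: "0 < m"
  shows "\<exists>(M :: (nat \<Rightarrow> real) measure) A. nonada_alg 0 m M A \<and> alg_error (ereal p) q m M A \<le> ennreal 3"
proof (rule uniform_finite_algorithm[where \<Omega> = "{()}" and N = "\<lambda>_ _. 0" and \<phi> = "\<lambda>_ _ _. 0"])
  fix x assume x: "lp_norm (ereal p) m x \<le> 1"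
  have "lp_norm q m x \<le> 3 * 1 powr (1 - real_of_ereal (ereal p / q))"
    using lp_norm_le_one_imp(2)[OF p x] by (intro lp_norm_le_interpolation[OF p pq m _ x]) auto
  then show "(\<Sum>\<omega>\<in>{()}. lp_norm q m (\<lambda>i. x i - 0)) \<le> 3 * real (card {()})" by simp
qed (use m in auto)

lemma identity_algorithm:
  fixes p :: real
  assumes p: "1 \<le> p" and pq: "ereal p < q" and m: "0 < m"
  shows "\<exists>(M :: (nat \<Rightarrow> real) measure) A. nonada_alg m m M A \<and> alg_error (ereal p) q m M A \<le> ennreal 0"
proof (rule uniform_finite_algorithm[where \<Omega> = "{()}" and N = "\<lambda>_ (i, j). if i = j then 1 else 0"
      and \<phi> = "\<lambda>_ y. y"])
  fix x :: "nat \<Rightarrow> real"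
  have "lp_norm q m (\<lambda>i. x i - mat_vec m m (\<lambda>(i, j). if i = j then 1 else 0) x i) = lp_norm q m (\<lambda>_. 0)"
    by (rule lp_norm_cong) (simp add: mat_vec_def if_distrib[of "\<lambda>t. t * _"] cong: if_cong)
  also have "\<dots> = 0"
  proof (cases "q = \<infinity>")
    case True
    have "(\<lambda>i. 0) ` {..<m} = {0 :: real}" using m by auto
    with True show ?thesis by (simp add: lp_norm_def)
  next
    case False
    then show ?thesis using p pq by (cases q) (auto simp: lp_norm_def)
  qed
  finally show "(\<Sum>\<omega>\<in>{()}. lp_norm q m (\<lambda>i. x i - mat_vec m m (\<lambda>(i, j). if i = j then 1 else 0) x i))
      \<le> 0 * real (card {()})" by simp
qed (use m in auto)

text \<open>
  The level \<open>\<tau>\<close> solves \<open>width p m / \<tau> powr min p 2 = B / 16\<close>, so that every point of the unit ball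
  meets the energy condition of \<open>card_noisy_rows\<close>.
\<close>

lemma sketch_algorithm:
  fixes p :: real and R :: nat
  assumes p: "1 \<le> p" and pq: "ereal p < q" and m: "0 < m" and B: "0 < B"
  shows "\<exists>(M :: (nat \<Rightarrow> real) measure) A. nonada_alg (R * B) m M A \<and>
    alg_error (ereal p) q m M A \<le>
      ennreal (6 * (16 * width p m / real B) powr rate p q + 2 * (real m)\<^sup>2 / 2 ^ R)"
proof (rule uniform_finite_algorithm)
  define s where "s = min p 2"
  define \<theta> where "\<theta> = 1 - real_of_ereal (ereal p / q)"
  have s: "0 < s" using p by (simp add: s_def)
  have W: "1 \<le> width p m" using one_le_width[OF p m] .
  define \<tau> where "\<tau> = (16 * width p m / real B) powr (1 / s)"
  have \<tau>: "0 < \<tau>" using W B by (simp add: \<tau>_def)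
  have \<tau>s: "\<tau> powr s = 16 * width p m / real B"
    using s W B by (simp add: \<tau>_def powr_powr)
  let ?\<Omega> = "{..<R} \<rightarrow>\<^sub>E row_space m B"
  show "finite ?\<Omega>" by (simp add: finite_PiE finite_row_space)
  show "?\<Omega> \<noteq> {}" using row_space_nonempty[OF B] by (simp add: PiE_eq_empty_iff)
  show "0 < m" by (rule m)
  fix x assume x: "lp_norm (ereal p) m x \<le> 1"
  have "(\<Sum>i<m. (min 1 (\<bar>x i\<bar> / \<tau>))\<^sup>2) \<le> width p m / \<tau> powr s"
    using sum_truncated_squares[OF p m \<tau> x] by (simp add: s_def)
  also have "\<dots> = real B / 16" using W B by (simp add: \<tau>s)
  finally have sparse: "(\<Sum>i<m. (min 1 (\<bar>x i\<bar> / \<tau>))\<^sup>2) \<le> real B / 16" .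
  have "(2 * \<tau>) powr \<theta> \<le> 2 * \<tau> powr \<theta>"
    using \<tau> exponent_bounds[OF p pq] by (intro powr_scale_le) (auto simp: \<theta>_def)
  also have "\<tau> powr \<theta> = (16 * width p m / real B) powr rate p q"
    by (simp add: \<tau>_def powr_powr rate_def \<theta>_def s_def)
  finally have "3 * (2 * \<tau>) powr \<theta> + 2 * (real m)\<^sup>2 / 2 ^ R \<le>
      6 * (16 * width p m / real B) powr rate p q + 2 * (real m)\<^sup>2 / 2 ^ R" by simp
  then have "(3 * (2 * \<tau>) powr \<theta> + 2 * (real m)\<^sup>2 / 2 ^ R) * real (card ?\<Omega>) \<le>
      (6 * (16 * width p m / real B) powr rate p q + 2 * (real m)\<^sup>2 / 2 ^ R) * real (card ?\<Omega>)"
    by (rule mult_right_mono) simp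
  with sketch_average_error[OF p pq m B \<tau> x lp_norm_le_one_imp(2)[OF p x] sparse, of R]
  show "(\<Sum>\<omega>\<in>?\<Omega>. lp_norm q m (\<lambda>j. x j - (\<lambda>\<omega> y j. decode R \<tau> (estimate B \<omega> y j)) \<omega>
        (mat_vec (R * B) m (sketch_matrix B \<omega>) x) j)) \<le>
      (6 * (16 * width p m / real B) powr rate p q + 2 * (real m)\<^sup>2 / 2 ^ R) * real (card ?\<Omega>)"
    by (simp add: \<theta>_def)
qed

text \<open>
  With \<open>R\<close> about \<open>3 * log 2 m\<close> repetitions the failures contribute at most \<open>2 / m\<close>, and
  \<open>B = n div R\<close> buckets use up the budget to within a factor \<open>2\<close>.  The constant is
  \<open>6 * 192 + 4\<close>: \<open>192 = 16 * 12\<close> arises from \<open>16 / B \<le> 192 * ln m / n\<close>, and \<open>4\<close> from the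
  failures.
\<close>

lemma algorithm_exists:
  fixes p :: real
  assumes p: "1 \<le> p" and pq: "ereal p < q" and m: "2 \<le> m" and n: "1 \<le> n"
  shows "\<exists>k \<le> n. \<exists>(M :: (nat \<Rightarrow> real) measure) A. nonada_alg k m M A \<and>
    alg_error (ereal p) q m M A \<le> ennreal (1156 * min 1 ((width p m * ln (real m) / real n) powr rate p q))"
proof -
  define a where "a = rate p q"
  define W where "W = width p m"
  define y where "y = W * ln (real m) / real n"
  have a: "0 < a" "a \<le> 1" using exponent_bounds[OF p pq] by (auto simp: a_def)
  have W: "1 \<le> W" using m one_le_width[OF p] by (simp add: W_def)
  have ln2: "1 / 2 \<le> ln (2::real)" using ln2_ge_two_thirds by simp
  have lnm: "ln 2 \<le> ln (real m)" "0 < ln (real m)" "ln (real m) < real m"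
    using m ln_less_self[of "real m"] by auto
  have y: "0 < y" using W lnm(1) ln2 n by (simp add: y_def)
  have goal: ?thesis
    if "k \<le> n" "\<exists>(M :: (nat \<Rightarrow> real) measure) A. nonada_alg k m M A \<and> alg_error (ereal p) q m M A \<le> ennreal E"
      "E \<le> 1156 * min 1 (y powr a)" for k E
  proof -
    have "ennreal E \<le> ennreal (1156 * min 1 (y powr a))" using that(3) by (rule ennreal_leI)
    then show ?thesis using that(1,2) unfolding y_def W_def a_def by (meson order_trans)
  qed
  \<comment> \<open>The factor \<open>6\<close> leaves room for at least one bucket: below, \<open>R \<le> 6 * ln m \<le> 6 * W * ln m < n\<close>.\<close>
  consider "m \<le> n" | "1 \<le> 6 * y" | "n < m" "6 * y < 1" by linarith
  then show ?thesis
  proof cases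
    case 1
    then show ?thesis
      using m by (intro goal[OF _ identity_algorithm[OF p pq]]) auto
  next
    case 2
    have "1 \<le> (6 * y) powr a" using 2 a by (intro ge_one_powr_ge_zero) auto
    also have "\<dots> \<le> 6 * y powr a" using y a by (intro powr_scale_le) auto
    finally have "3 \<le> 1156 * min 1 (y powr a)" by (auto simp: min_def)
    then show ?thesis
      using m by (intro goal[OF _ zero_algorithm[OF p pq]]) auto
  next
    case 3
    define R where "R = nat \<lceil>3 * ln (real m) / ln 2\<rceil>"
    have R0: "3 * ln (real m) / ln 2 \<le> real R"
      unfolding R_def by (rule real_nat_ceiling_ge)
    have "real R \<le> 3 * ln (real m) / ln 2 + 1"
      unfolding R_def using ln2 lnm by (simp add: of_nat_nat)
    also have "1 \<le> ln (real m) / ln 2" using ln2 lnm by simp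
    also have "3 * ln (real m) / ln 2 + ln (real m) / ln 2 = 4 * ln (real m) / ln 2" by simp
    also have "\<dots> \<le> 6 * ln (real m)"
    proof -
      have "4 * ln (real m) \<le> (6 * ln (real m)) * ln 2"
        using mult_left_mono[of "2/3" "ln (2::real)" "6 * ln (real m)"] ln2_ge_two_thirds lnm ln2 by simp
      then show ?thesis by (simp add: divide_le_eq)
    qed
    finally have R6: "real R \<le> 6 * ln (real m)" by simp
    have "6 * ln (real m) \<le> 6 * (W * ln (real m))"
      using W lnm ln2 mult_right_mono[of 1 W "ln (real m)"] by simp
    also have "\<dots> < real n" using 3 n by (simp add: y_def field_simps)
    finally have Rn: "real R < real n" using R6 by simp
    have "0 < 3 * ln (real m) / ln 2" using lnm ln2 by simp
    then have Rpos: "0 < R" using R0 by linarith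
    define B where "B = n div R"
    have B: "0 < B" using Rn Rpos by (simp add: B_def div_greater_zero_iff)
    have RB: "R * B \<le> n" by (simp add: B_def)
    have "n < 2 * (R * B)"
    proof -
      have "n mod R < R" using Rpos by simp
      moreover have "n = R * B + n mod R" by (simp add: B_def)
      moreover have "R \<le> R * B" using B by simp
      ultimately show ?thesis by linarith
    qed
    then have "real n < 2 * (real R * real B)" by (simp flip: of_nat_mult)
    also have "\<dots> \<le> 2 * (6 * ln (real m) * real B)"
      using R6 by (intro mult_left_mono mult_right_mono) auto
    finally have nB: "real n < 12 * ln (real m) * real B" by simp
    have "16 * W / real B \<le> 192 * y"
    proof -
      have "W * real n \<le> W * (12 * ln (real m) * real B)"
        using nB W by (intro mult_left_mono) auto
      then show ?thesis using B n by (simp add: y_def field_simps)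
    qed
    then have "(16 * W / real B) powr a \<le> (192 * y) powr a"
      using W B a by (intro powr_mono2) auto
    also have "\<dots> \<le> 192 * y powr a" using y a by (intro powr_scale_le) auto
    finally have main: "6 * (16 * W / real B) powr a \<le> 1152 * y powr a" by simp
    have "real m ^ 3 = exp (3 * ln (real m))"
      using m by (simp add: exp_of_nat_mult[of 3, simplified])
    also have "\<dots> \<le> exp (real R * ln 2)"
      using R0 ln2 by (simp add: divide_le_eq)
    also have "\<dots> = 2 ^ R" by (simp add: exp_of_nat_mult)
    finally have "real m ^ 3 \<le> 2 ^ R" .
    then have "2 * (real m)\<^sup>2 / 2 ^ R \<le> 2 * (real m)\<^sup>2 / real m ^ 3"
      using m by (intro divide_left_mono) auto
    also have "\<dots> = 4 * ((1 / 2) / real m)"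
      using m by (simp add: power2_eq_square power3_eq_cube)
    \<comment> \<open>A budget \<open>n < m\<close> forces the target \<open>y\<close> to be at least of order \<open>1 / m\<close>.\<close>
    also have "(1 / 2) / real m \<le> y"
    proof -
      have "1 / 2 \<le> ln (real m)" using ln2 lnm(1) by linarith
      then have "1 / 2 * 1 \<le> ln (real m) * W"
        using lnm W by (intro mult_mono) auto
      then have "(1 / 2) / real m \<le> ln (real m) * W / real n"
        using 3 n by (intro frac_le) auto
      then show ?thesis by (simp add: y_def mult.commute)
    qed
    also have "y \<le> y powr a"
      using powr_mono'[of a 1 y] 3 y a by simp
    finally have fail: "2 * (real m)\<^sup>2 / 2 ^ R \<le> 4 * y powr a" by simp
    have "y powr a \<le> 1 powr a" using y 3 a by (intro powr_mono2) auto
    then have "min 1 (y powr a) = y powr a" by simp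
    then have "6 * (16 * W / real B) powr a + 2 * (real m)\<^sup>2 / 2 ^ R \<le> 1156 * min 1 (y powr a)"
      using main fail by simp
    then show ?thesis
      using goal[OF RB sketch_algorithm[OF p pq _ B, of m R]] m by (simp add: W_def a_def)
  qed
qed

section \<open>The error and cardinality bounds\<close>

text \<open>
  Both forms rest on \<open>1 - p / q = p * (1 / p - 1 / q)\<close>.
\<close>

lemma rate_cases:
  fixes p :: real
  assumes p: "1 \<le> p" and pq: "ereal p < q"
  shows "p \<le> 2 \<Longrightarrow> rate p q = 1 / p - real_of_ereal (1 / q)"
    and "2 < p \<Longrightarrow> rate p q = 1 / 2 * (1 - real_of_ereal (ereal p / q))"
    and "2 < p \<Longrightarrow> 1 / rate p q = (2 / p) / (1 / p - real_of_ereal (1 / q))"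
proof -
  have *: "1 - real_of_ereal (ereal p / q) = p * (1 / p - real_of_ereal (1 / q))"
    using p pq by (cases q) (simp_all add: field_simps one_ereal_def)
  show "p \<le> 2 \<Longrightarrow> rate p q = 1 / p - real_of_ereal (1 / q)"
    using p unfolding rate_def * by simp
  show "2 < p \<Longrightarrow> rate p q = 1 / 2 * (1 - real_of_ereal (ereal p / q))"
    unfolding rate_def by simp
  show "2 < p \<Longrightarrow> 1 / rate p q = (2 / p) / (1 / p - real_of_ereal (1 / q))"
    using p unfolding rate_def * by (simp add: min_def)
qed

text \<open>
  The number \<open>t\<close> below solves \<open>1156 * (width p m * ln m / t) powr rate p q = \<epsilon>\<close>.  Rounding it up
  costs at most \<open>1\<close>, which the factor \<open>ln m\<close> dominates because \<open>m \<ge> 2\<close> and \<open>\<epsilon> < 1\<close>.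
\<close>

lemma cardinality_bound:
  fixes p \<epsilon> :: real
  assumes p: "1 \<le> p" and pq: "ereal p < q" and m: "2 \<le> m" and \<epsilon>: "0 < \<epsilon>" "\<epsilon> < 1"
  defines "a \<equiv> rate p q"
  shows "n_ran_nonada TYPE(nat \<Rightarrow> real) \<epsilon> (ereal p) q m \<le>
    ennreal ((1156 powr (1 / a) + 2) * (\<epsilon> powr (- 1 / a) * width p m * ln (real m)))"
proof -
  define V where "V = width p m * ln (real m)"
  have a: "0 < a" using exponent_bounds[OF p pq] by (simp add: a_def)
  have lnm: "2 / 3 \<le> ln (real m)"
    using ln2_ge_two_thirds m ln_le_cancel_iff[of 2 "real m"] by linarith
  have "1 * (2 / 3) \<le> V"
    unfolding V_def using one_le_width[OF p, of m] m lnm by (intro mult_mono) auto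
  then have V: "1 / 2 \<le> V" by simp
  define t where "t = V * (1156 / \<epsilon>) powr (1 / a)"
  have t: "0 < t" using V \<epsilon> by (simp add: t_def)
  define n where "n = nat \<lceil>t\<rceil>"
  have tn: "t \<le> real n" unfolding n_def by (rule real_nat_ceiling_ge)
  have nt: "real n \<le> t + 1" using t unfolding n_def by (simp add: of_nat_nat)
  have n: "1 \<le> n" using tn t by linarith
  have "1156 * min 1 ((V / real n) powr a) \<le> 1156 * (V / t) powr a"
    using V t tn a by (intro mult_left_mono min.coboundedI2 powr_mono2 divide_left_mono) auto
  also have "V / t = (1156 / \<epsilon>) powr (- 1 / a)"
    using V by (simp add: t_def powr_minus field_simps)
  also have "\<dots> powr a = \<epsilon> / 1156"
    unfolding powr_powr using a \<epsilon> by (simp add: powr_minus)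
  finally have err: "1156 * min 1 ((V / real n) powr a) \<le> \<epsilon>" by simp
  obtain k M A where k: "k \<le> n" "nonada_alg k m (M :: (nat \<Rightarrow> real) measure) A"
    "alg_error (ereal p) q m M A \<le> ennreal (1156 * min 1 ((V / real n) powr a))"
    using algorithm_exists[OF p pq m n] unfolding V_def a_def by blast
  have "alg_error (ereal p) q m M A \<le> ennreal \<epsilon>"
    using k(3) ennreal_leI[OF err] by (rule order_trans)
  then have "n_ran_nonada TYPE(nat \<Rightarrow> real) \<epsilon> (ereal p) q m \<le> of_nat k"
    unfolding n_ran_nonada_def using k(2) by (intro Inf_lower) blast
  also have "of_nat k = ennreal (real k)" by (simp add: ennreal_of_nat_eq_real_of_nat)
  also have "\<dots> \<le> ennreal ((1156 powr (1 / a) + 2) * (\<epsilon> powr (- 1 / a) * V))"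
  proof (rule ennreal_leI)
    have e: "1 powr (- 1 / a) \<le> \<epsilon> powr (- 1 / a)"
      using a \<epsilon> by (intro powr_mono2') auto
    have "1 \<le> 2 * (\<epsilon> powr (- 1 / a) * V)"
      using mult_mono[OF e V] by simp
    moreover have "(1156 / \<epsilon>) powr (1 / a) = 1156 powr (1 / a) * \<epsilon> powr (- 1 / a)"
      using \<epsilon> by (simp add: powr_divide powr_minus_divide)
    then have "t = 1156 powr (1 / a) * (\<epsilon> powr (- 1 / a) * V)"
      by (simp add: t_def)
    ultimately show "real k \<le> (1156 powr (1 / a) + 2) * (\<epsilon> powr (- 1 / a) * V)"
      using k(1) nt by (simp add: distrib_right)
  qed
  finally show ?thesis by (simp add: V_def mult.assoc)
qed

theorem theorem4p4:
  fixes p :: real and q :: ereal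
  assumes "1 \<le> p" and "ereal p < q"
  shows "\<exists>C > 0.
    (\<forall>m n :: nat. m \<ge> 2 \<longrightarrow> n \<ge> 1 \<longrightarrow>
       e_ran_nonada TYPE(nat \<Rightarrow> real) n (ereal p) q m \<le>
         ennreal (C *
           (if p \<le> 2
            then min 1 ((ln (real m) / real n) powr (1 / p - real_of_ereal (1 / q)))
            else min 1 ((real m powr (1 - 2 / p) * ln (real m) / real n)
                          powr (1 / 2 * (1 - real_of_ereal (ereal p / q))))))) \<and>
    (\<forall>(m :: nat) (\<epsilon> :: real). m \<ge> 2 \<longrightarrow> 0 < \<epsilon> \<longrightarrow> \<epsilon> < 1 \<longrightarrow>
       n_ran_nonada TYPE(nat \<Rightarrow> real) \<epsilon> (ereal p) q m \<le>
         ennreal (C *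
           (if p \<le> 2
            then \<epsilon> powr (- 1 / (1 / p - real_of_ereal (1 / q))) * ln (real m)
            else \<epsilon> powr (- (2 / p) / (1 / p - real_of_ereal (1 / q)))
                   * real m powr (1 - 2 / p) * ln (real m))))"
proof -
  note rate = rate_cases[OF assms]
  define C :: real where "C = 1156 + (1156 powr (1 / rate p q) + 2)"
  have C: "1156 \<le> C" "1156 powr (1 / rate p q) + 2 \<le> C" by (auto simp: C_def)
  show ?thesis
  proof (intro exI[of _ C] conjI allI impI)
    show "0 < C" using C by simp
  next
    fix m n :: nat assume mn: "2 \<le> m" "1 \<le> n"
    let ?t = "min 1 ((width p m * ln (real m) / real n) powr rate p q)"
    obtain k M A where "k \<le> n" "nonada_alg k m (M :: (nat \<Rightarrow> real) measure) A"
      and err: "alg_error (ereal p) q m M A \<le> ennreal (1156 * ?t)"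
      using algorithm_exists[OF assms mn] by blast
    then have "e_ran_nonada TYPE(nat \<Rightarrow> real) n (ereal p) q m \<le> alg_error (ereal p) q m M A"
      unfolding e_ran_nonada_def by (intro Inf_lower) blast
    also note err
    also have "ennreal (1156 * ?t) \<le> ennreal (C * ?t)"
      using C by (intro ennreal_leI mult_right_mono) auto
    also have "?t = (if p \<le> 2
            then min 1 ((ln (real m) / real n) powr (1 / p - real_of_ereal (1 / q)))
            else min 1 ((real m powr (1 - 2 / p) * ln (real m) / real n)
                          powr (1 / 2 * (1 - real_of_ereal (ereal p / q)))))"
      by (simp add: width_def rate(1,2))
    finally show "e_ran_nonada TYPE(nat \<Rightarrow> real) n (ereal p) q m \<le> ennreal (C * \<dots>)" .
  next
    fix m :: nat and \<epsilon> :: real assume m\<epsilon>: "2 \<le> m" "0 < \<epsilon>" "\<epsilon> < 1"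
    let ?t = "\<epsilon> powr (- 1 / rate p q) * width p m * ln (real m)"
    have "0 \<le> ?t" using one_le_width[OF assms(1), of m] m\<epsilon> by simp
    note cardinality_bound[OF assms m\<epsilon>]
    also have "ennreal ((1156 powr (1 / rate p q) + 2) * ?t) \<le> ennreal (C * ?t)"
      using C \<open>0 \<le> ?t\<close> by (intro ennreal_leI mult_right_mono) auto
    also have "?t = (if p \<le> 2
            then \<epsilon> powr (- 1 / (1 / p - real_of_ereal (1 / q))) * ln (real m)
            else \<epsilon> powr (- (2 / p) / (1 / p - real_of_ereal (1 / q)))
                   * real m powr (1 - 2 / p) * ln (real m))"
      using rate(1,3) by (simp add: width_def)
    finally show "n_ran_nonada TYPE(nat \<Rightarrow> real) \<epsilon> (ereal p) q m \<le> ennreal (C * \<dots>)" .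
  qed
qed

end
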